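(* If $G$ is a connected graph of order at least $3$, then $b_{\rm R}(G)\le 2\Delta(G)+\lambda(G)-3$, where $\lambda(G)$ is the edge-connectivity of $G$.
   Context: Graphs are finite, undirected, without loops or multiple edges; a graph is nonempty if it has at least one edge; $\Delta(G)$ is the maximum degree. The edge-connectivity $\lambda(G)$ is the minimum number of edges whose removal makes $G$ disconnected. A Roman dominating function on $G=(V,E)$ is a function $f:V\to\{0,1,2\}$ such that every vertex $x$ with $f(x)=0$ is adjacent to at least one vertex $y$ with $f(y)=2$. Its weight is $\sum_{u\in V}f(u)$. The Roman domination number $\gamma_{\rm R}(G)$ is the minimum weight of a Roman dominating function on $G$. The Roman bondage number of a nonempty graph $G$ is $b_{\rm R}(G)=\min\{|B|: B\subseteq E(G),\ \gamma_{\rm R}(G-B)>\gamma_{\rm R}(G)\}$, with $b_{\rm R}(G)=\infty$ if no such $B$ exists; here $G-B$ is obtained from $G$ by deleting the edges in $B$ (keeping all vertices). *)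

theory Defs
  imports Main "HOL-Library.Extended_Nat"
begin

text \<open>
  A finite simple graph is given by a vertex set \<open>V\<close> and a set \<open>E\<close> of edges, each edge being a
  two-element subset of \<open>V\<close>. The graph obtained by deleting the edges in \<open>B\<close> is given by
  \<open>V\<close> and \<open>E - B\<close>.
\<close>

locale simple_graph =
  fixes V :: "'a set" and E :: "'a set set"
  assumes finite_verts: "finite V"
    and edges: "E \<subseteq> {e. e \<subseteq> V \<and> card e = 2}"

definition adjacent :: "'a set set \<Rightarrow> 'a \<Rightarrow> 'a \<Rightarrow> bool" where
  "adjacent E u v \<longleftrightarrow> {u, v} \<in> E"

definition degree :: "'a set set \<Rightarrow> 'a \<Rightarrow> nat" where
  "degree E v = card {e \<in> E. v \<in> e}"

definition max_degree :: "'a set \<Rightarrow> 'a set set \<Rightarrow> nat" where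
  "max_degree V E = Max (degree E ` V)"

definition connected_graph :: "'a set \<Rightarrow> 'a set set \<Rightarrow> bool" where
  "connected_graph V E \<longleftrightarrow> V \<noteq> {} \<and> (\<forall>u\<in>V. \<forall>v\<in>V. (adjacent E)\<^sup>*\<^sup>* u v)"

text \<open>
  The infimum is a minimum as soon as \<open>V\<close> has at least two elements, since then deleting all edges
  disconnects the graph. If no edge set disconnects it, the value is the convention
  \<open>Inf {} = 0\<close> on the naturals.
\<close>

definition edge_connectivity :: "'a set \<Rightarrow> 'a set set \<Rightarrow> nat" where
  "edge_connectivity V E = Inf {card F | F. F \<subseteq> E \<and> \<not> connected_graph V (E - F)}"

text \<open>Only the values of \<open>f\<close> on \<open>V\<close> matter, both here and for the weight below.\<close>

definition roman_dominating :: "'a set \<Rightarrow> 'a set set \<Rightarrow> ('a \<Rightarrow> nat) \<Rightarrow> bool" where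
  "roman_dominating V E f \<longleftrightarrow>
     f ` V \<subseteq> {0, 1, 2} \<and>
     (\<forall>x\<in>V. f x = 0 \<longrightarrow> (\<exists>y\<in>V. adjacent E x y \<and> f y = 2))"

text \<open>The infimum is a minimum: the constant function 1 is always Roman dominating.\<close>

definition roman_domination_number :: "'a set \<Rightarrow> 'a set set \<Rightarrow> nat" where
  "roman_domination_number V E = Inf {(\<Sum>u\<in>V. f u) | f. roman_dominating V E f}"

text \<open>In \<^typ>\<open>enat\<close>, \<open>Inf {} = \<infinity>\<close>, as wanted when no suitable edge set \<open>B\<close> exists.\<close>

definition roman_bondage_number :: "'a set \<Rightarrow> 'a set set \<Rightarrow> enat" where
  "roman_bondage_number V E =
     Inf {enat (card B) | B. B \<subseteq> E \<and>
       roman_domination_number V (E - B) > roman_domination_number V E}"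

end

theory Submission
  imports Defs
begin

text \<open>
  Let \<open>F\<close> be a minimum edge cut and \<open>{x, y}\<close> one of its edges. Restoring this single edge to
  \<open>G - F\<close> gives a connected graph with at least three vertices, so \<open>x\<close> or \<open>y\<close> is incident with an
  edge outside \<open>F\<close>; by symmetry let \<open>{x, w}\<close> be such an edge
  (\<open>minimum_edge_cut_properties\<close>). Two sets of deleted edges are compared.

  \<^item> \<open>F\<close> together with all edges at \<open>x\<close> or \<open>w\<close> except \<open>{x, w}\<close>. As \<open>{x, y}\<close> lies in \<open>F\<close>, this
    costs at most \<open>(\<Delta> - 2) + (\<Delta> - 1)\<close> edges beyond \<open>F\<close>. The edge \<open>{x, w}\<close> is now a component,
    and it needs weight 2, which may all be put on \<open>x\<close> (\<open>roman_dominating_isolated_edge\<close>).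

  \<^item> \<open>F\<close> together with all edges at \<open>y\<close>, which costs at most \<open>\<Delta> - 1 \<le> 2 \<Delta> - 3\<close> edges beyond
    \<open>F\<close>. Now \<open>y\<close> is isolated and may be given weight 1 (\<open>roman_dominating_isolated_vertex\<close>).

  Suppose that neither deletion raises the Roman domination number \<open>\<gamma>\<close>. Then there are functions
  \<open>f\<close> and \<open>g\<close> of weight at most \<open>\<gamma>\<close> that are Roman dominating already in \<open>G - F\<close>, with \<open>f x = 2\<close>
  and \<open>g y = 1\<close>. No edge of \<open>G - F\<close> leaves the side of the cut that contains \<open>x\<close>, so \<open>f\<close> on that
  side may be glued with \<open>g\<close> on the other; comparing with the opposite gluing, this function has
  weight at most \<open>\<gamma>\<close>. In \<open>G\<close> the edge \<open>{x, y}\<close> is back, and since \<open>x\<close> has value 2 the value of \<open>y\<close>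
  can drop to 0. This gives weight at most \<open>\<gamma> - 1\<close>, a contradiction.
\<close>

section \<open>Roman dominating functions\<close>

lemma adjacent_sym: "adjacent E u v \<longleftrightarrow> adjacent E v u"
  by (simp add: adjacent_def insert_commute)

lemma roman_dominating_mono:
  assumes "roman_dominating V D f" "D \<subseteq> E"
  shows "roman_dominating V E f"
proof -
  have "adjacent E u v" if "adjacent D u v" for u v
    using that assms(2) unfolding adjacent_def by blast
  then show ?thesis using assms(1) unfolding roman_dominating_def by fast
qed

lemma roman_dominating_witness:
  assumes "roman_dominating V E f" "x \<in> V" "f x = 0"
  obtains y where "y \<in> V" "adjacent E x y" "f y = 2"
  using assms unfolding roman_dominating_def by metis

lemma roman_domination_number_le:
  assumes "roman_dominating V E f"
  shows "roman_domination_number V E \<le> sum f V"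
proof -
  have "sum f V \<in> {(\<Sum>u\<in>V. f u) | f. roman_dominating V E f}"
    using assms by (intro CollectI exI[of _ f]) simp
  then show ?thesis
    unfolding roman_domination_number_def by (rule wellorder_Inf_le1)
qed

lemma roman_domination_number_attained:
  obtains f where "roman_dominating V E f" "sum f V = roman_domination_number V E"
proof -
  let ?S = "{(\<Sum>u\<in>V. f u) | f. roman_dominating V E f}"
  have "roman_dominating V E (\<lambda>_. 1)"
    by (auto simp: roman_dominating_def)
  then have "?S \<noteq> {}" by blast
  then have "Inf ?S \<in> ?S" by (rule Inf_nat_def1)
  then show thesis
    using that unfolding roman_domination_number_def by auto
qed

lemma roman_dominating_isolated_vertex:
  assumes "finite V" "y \<in> V" and iso: "\<And>v. \<not> adjacent D y v"
    and f: "roman_dominating V D f"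
  shows "\<exists>g. roman_dominating V D g \<and> g y = 1 \<and> sum g V \<le> sum f V"
proof (intro exI conjI)
  let ?g = "f(y := 1)"
  have iso': "\<not> adjacent D v y" for v
    using iso[of v] adjacent_sym[of D v y] by simp
  show "roman_dominating V D ?g"
    unfolding roman_dominating_def
  proof (intro conjI ballI impI)
    show "?g ` V \<subseteq> {0, 1, 2}"
      using f unfolding roman_dominating_def by auto
    fix z assume "z \<in> V" "?g z = 0"
    then have "f z = 0" by (auto split: if_splits)
    then obtain v where v: "v \<in> V" "adjacent D z v" "f v = 2"
      using roman_dominating_witness[OF f \<open>z \<in> V\<close>] by metis
    then have "v \<noteq> y" using iso' by blast
    then show "\<exists>v\<in>V. adjacent D z v \<and> ?g v = 2" using v by auto
  qed
  have "f y \<noteq> 0"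
    using roman_dominating_witness[OF f \<open>y \<in> V\<close>] iso by metis
  then show "sum ?g V \<le> sum f V"
    by (intro sum_mono) auto
qed simp

text \<open>
  On a component that is a single edge, any Roman dominating function has weight at least 2: either
  one end has value 0 and the other 2, or both values are positive.
\<close>

lemma roman_dominating_isolated_edge:
  assumes "finite V" "x \<in> V" "w \<in> V" "x \<noteq> w" and edge: "adjacent D x w"
    and iso: "\<And>v. adjacent D x v \<Longrightarrow> v = w" "\<And>v. adjacent D w v \<Longrightarrow> v = x"
    and f: "roman_dominating V D f"
  shows "\<exists>g. roman_dominating V D g \<and> g x = 2 \<and> sum g V \<le> sum f V"
proof (intro exI conjI)
  let ?g = "f(x := 2, w := 0)"
  show "roman_dominating V D ?g"
    unfolding roman_dominating_def
  proof (intro conjI ballI impI)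
    show "?g ` V \<subseteq> {0, 1, 2}"
      using f unfolding roman_dominating_def by auto
    fix z assume z: "z \<in> V" "?g z = 0"
    show "\<exists>v\<in>V. adjacent D z v \<and> ?g v = 2"
    proof (cases "z = w")
      case True
      then show ?thesis
        using edge \<open>x \<in> V\<close> \<open>x \<noteq> w\<close> adjacent_sym[of D x w] by auto
    next
      case False
      then have "z \<noteq> x" "f z = 0" using z by (auto split: if_splits)
      then obtain v where v: "v \<in> V" "adjacent D z v" "f v = 2"
        using roman_dominating_witness[OF f z(1)] by metis
      then have "v \<noteq> x" "v \<noteq> w"
        using iso[of z] adjacent_sym[of D z v] False \<open>z \<noteq> x\<close> by auto
      then show ?thesis using v by auto
    qed
  qed
  show "?g x = 2" using \<open>x \<noteq> w\<close> by simp
  have ends: "f x + f w \<ge> 2"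
  proof (cases "f x = 0 \<or> f w = 0")
    case True
    then show ?thesis
    proof
      assume "f x = 0"
      then obtain v where "adjacent D x v" "f v = 2"
        using roman_dominating_witness[OF f \<open>x \<in> V\<close>] by metis
      then show ?thesis using iso(1) by fastforce
    next
      assume "f w = 0"
      then obtain v where "adjacent D w v" "f v = 2"
        using roman_dominating_witness[OF f \<open>w \<in> V\<close>] by metis
      then show ?thesis using iso(2) by fastforce
    qed
  qed auto
  have split: "sum h V = h x + h w + sum h (V - {x, w})" for h :: "'a \<Rightarrow> nat"
    using sum.subset_diff[of "{x, w}" V h] assms(1-4) by simp
  have "sum ?g (V - {x, w}) = sum f (V - {x, w})"
    by (intro sum.cong) auto
  then show "sum ?g V \<le> sum f V"
    using split[of ?g] split[of f] ends \<open>x \<noteq> w\<close> by simp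
qed

section \<open>Gluing across a cut\<close>

lemma roman_dominating_glue:
  assumes f: "roman_dominating V D f" and g: "roman_dominating V D g"
    and cut: "\<And>u v. u \<in> A \<Longrightarrow> v \<in> V - A \<Longrightarrow> \<not> adjacent D u v"
  shows "roman_dominating V D (\<lambda>v. if v \<in> A then f v else g v)"
  unfolding roman_dominating_def
proof (intro conjI ballI impI)
  show "(\<lambda>v. if v \<in> A then f v else g v) ` V \<subseteq> {0, 1, 2}"
    using f g unfolding roman_dominating_def by auto
  fix z assume z: "z \<in> V" "(if z \<in> A then f z else g z) = 0"
  show "\<exists>v\<in>V. adjacent D z v \<and> (if v \<in> A then f v else g v) = 2"
  proof (cases "z \<in> A")
    case True
    then obtain v where "v \<in> V" "adjacent D z v" "f v = 2"
      using z roman_dominating_witness[OF f z(1)] by auto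
    then show ?thesis using cut True by auto
  next
    case False
    then obtain v where "v \<in> V" "adjacent D z v" "g v = 2"
      using z roman_dominating_witness[OF g z(1)] by auto
    moreover from this have "v \<notin> A"
      using cut[of v z] False z(1) adjacent_sym[of D z v] by auto
    ultimately show ?thesis by auto
  qed
qed

text \<open>
  The two gluings of \<open>f\<close> and \<open>g\<close> together weigh as much as \<open>f\<close> and \<open>g\<close> together, and neither is
  lighter than the optimum; so if \<open>f\<close> and \<open>g\<close> were both optimal in \<open>G\<close>, then both gluings would be
  too. But the gluing that has value 2 at \<open>x\<close> and 1 at \<open>y\<close> is not optimal in the presence of the
  edge \<open>{x, y}\<close>.
\<close>

lemma roman_dominating_cut_edge_weight:
  assumes "finite V" "D \<subseteq> E" "x \<in> A" "x \<in> V" "y \<in> V - A" and xy: "{x, y} \<in> E"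
    and cut: "\<And>u v. u \<in> A \<Longrightarrow> v \<in> V - A \<Longrightarrow> \<not> adjacent D u v"
    and f: "roman_dominating V D f" "f x = 2"
    and g: "roman_dominating V D g" "g y = 1"
  shows "sum f V + sum g V > 2 * roman_domination_number V E"
proof -
  let ?fg = "\<lambda>v. if v \<in> A then f v else g v"
  let ?gf = "\<lambda>v. if v \<in> A then g v else f v"
  let ?h = "?fg(y := 0)"
  have fg: "roman_dominating V D ?fg"
    by (rule roman_dominating_glue) (use f g cut in auto)
  have "roman_dominating V D ?gf"
    by (rule roman_dominating_glue) (use f g cut in auto)
  then have gf_weight: "roman_domination_number V E \<le> sum ?gf V"
    using roman_dominating_mono[OF _ \<open>D \<subseteq> E\<close>] roman_domination_number_le by blast
  have "roman_dominating V E ?h"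
    unfolding roman_dominating_def
  proof (intro conjI ballI impI)
    show "?h ` V \<subseteq> {0, 1, 2}"
      using fg unfolding roman_dominating_def by auto
    fix z assume z: "z \<in> V" "?h z = 0"
    show "\<exists>v\<in>V. adjacent E z v \<and> ?h v = 2"
    proof (cases "z = y")
      case True
      then have "adjacent E z x" "?h x = 2"
        using xy f(2) assms(3,5) by (auto simp: adjacent_def insert_commute)
      then show ?thesis using \<open>x \<in> V\<close> by blast
    next
      case False
      then have "?fg z = 0" using z by simp
      then obtain v where v: "v \<in> V" "adjacent D z v" "?fg v = 2"
        using roman_dominating_witness[OF fg z(1)] by metis
      then have "v \<noteq> y" using g(2) assms(5) by auto
      then show ?thesis
        using v \<open>D \<subseteq> E\<close> by (auto simp: adjacent_def)
    qed
  qed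
  then have h_weight: "roman_domination_number V E \<le> sum ?h V"
    by (rule roman_domination_number_le)
  have "sum ?h V < sum ?fg V"
    using assms(1,5) g(2) by (intro sum_strict_mono_ex1) auto
  moreover have "sum ?fg V + sum ?gf V = sum f V + sum g V"
    by (simp add: sum.distrib[symmetric] if_distrib cong: if_cong) (intro sum.cong, auto)
  ultimately show ?thesis using gf_weight h_weight by linarith
qed

section \<open>Counting the deleted edges\<close>

lemma (in simple_graph) finite_edges: "finite E"
proof (rule finite_subset)
  show "E \<subseteq> Pow V" using edges by blast
qed (simp add: finite_verts)

lemma (in simple_graph) edge_ends:
  assumes "{u, v} \<in> E"
  shows "u \<in> V \<and> v \<in> V \<and> u \<noteq> v"
proof -
  have "{u, v} \<subseteq> V" "card {u, v} = 2" using edges assms by blast+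
  then show ?thesis by (cases "u = v") simp_all
qed

lemma (in simple_graph) degree_le_max_degree: "v \<in> V \<Longrightarrow> degree E v \<le> max_degree V E"
  unfolding max_degree_def using finite_verts by simp

lemma (in simple_graph) card_incident_edges_diff:
  assumes "v \<in> V" "S \<subseteq> {e \<in> E. v \<in> e}"
  shows "card ({e \<in> E. v \<in> e} - S) + card S \<le> max_degree V E"
proof -
  have fin: "finite {e \<in> E. v \<in> e}" using finite_edges by simp
  have "card ({e \<in> E. v \<in> e} - S) + card S = degree E v"
    unfolding degree_def
    using card_Diff_subset[OF finite_subset[OF assms(2) fin] assms(2)] card_mono[OF fin assms(2)]
    by simp
  then show ?thesis using degree_le_max_degree[OF assms(1)] by simp
qed

text \<open>
  The side \<open>A\<close> is only required to contain \<open>x\<close> but not \<open>y\<close> and to be closed in \<open>G - F\<close>; so the lemma also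
  applies with the two sides and the ends of the cut edge exchanged, which covers the case that
  only \<open>y\<close> has a neighbour on its own side.
\<close>

lemma (in simple_graph) roman_bondage_at_cut_edge:
  assumes "F \<subseteq> E" and xy: "{x, y} \<in> F" and xw: "{x, w} \<in> E - F"
    and "x \<in> A" "y \<in> V - A"
    and cut: "\<And>u v. u \<in> A \<Longrightarrow> v \<in> V - A \<Longrightarrow> \<not> adjacent (E - F) u v"
  shows "\<exists>B\<subseteq>E. roman_domination_number V E < roman_domination_number V (E - B)
    \<and> card B + 3 \<le> 2 * max_degree V E + card F"
proof (rule ccontr)
  assume "\<not> ?thesis"
  then have stable: "roman_domination_number V (E - B) \<le> roman_domination_number V E"
    if "B \<subseteq> E" "card B + 3 \<le> 2 * max_degree V E + card F" for B
    using that not_less by blast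
  have ends: "x \<in> V" "y \<in> V" "w \<in> V" "x \<noteq> y" "x \<noteq> w"
    using edge_ends[of x y] edge_ends[of x w] assms(1) xy xw by auto
  have neq: "{x, y} \<noteq> {x, w}" using xy xw by auto
  let ?I = "\<lambda>v. {e \<in> E. v \<in> e}"
  have "{{x, y}, {x, w}} \<subseteq> ?I x" using xy xw \<open>F \<subseteq> E\<close> by auto
  moreover have "card {{x, y}, {x, w}} = 2" using neq by simp
  ultimately have x_count: "card (?I x - {{x, y}, {x, w}}) + 2 \<le> max_degree V E"
    using card_incident_edges_diff[OF ends(1), of "{{x, y}, {x, w}}"] by argo
  have w_count: "card (?I w - {{x, w}}) + 1 \<le> max_degree V E"
    using card_incident_edges_diff[of w "{{x, w}}"] ends xw by auto
  have y_count: "card (?I y - {{x, y}}) + 1 \<le> max_degree V E"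
    using card_incident_edges_diff[of y "{{x, y}}"] ends xy \<open>F \<subseteq> E\<close> by auto

  let ?B1 = "F \<union> (?I x - {{x, y}, {x, w}}) \<union> (?I w - {{x, w}})"
  have "card ?B1 \<le> card F + card (?I x - {{x, y}, {x, w}}) + card (?I w - {{x, w}})"
    by (intro order.trans[OF card_Un_le] add_right_mono card_Un_le)
  then have B1: "roman_domination_number V (E - ?B1) \<le> roman_domination_number V E"
    using \<open>F \<subseteq> E\<close> x_count w_count by (intro stable) auto
  obtain f0 where f0: "roman_dominating V (E - ?B1) f0"
      "sum f0 V = roman_domination_number V (E - ?B1)"
    by (rule roman_domination_number_attained)
  have "\<exists>f. roman_dominating V (E - ?B1) f \<and> f x = 2 \<and> sum f V \<le> sum f0 V"
  proof (rule roman_dominating_isolated_edge)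
    show "adjacent (E - ?B1) x w" using xw by (auto simp: adjacent_def)
    show "v = w" if "adjacent (E - ?B1) x v" for v
      using that xy by (auto simp: adjacent_def doubleton_eq_iff)
    show "v = x" if "adjacent (E - ?B1) w v" for v
      using that by (auto simp: adjacent_def doubleton_eq_iff)
  qed (use ends f0 finite_verts in auto)
  then obtain f where f: "roman_dominating V (E - ?B1) f" "f x = 2" "sum f V \<le> sum f0 V"
    by blast
  have f': "roman_dominating V (E - F) f"
    by (rule roman_dominating_mono[OF f(1)]) auto

  let ?B2 = "F \<union> (?I y - {{x, y}})"
  have "card ?B2 \<le> card F + card (?I y - {{x, y}})"
    by (rule card_Un_le)
  \<comment> \<open>\<open>x_count\<close> gives \<open>\<Delta> \<ge> 2\<close>, hence \<open>\<Delta> - 1 \<le> 2 \<Delta> - 3\<close>.\<close>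
  then have B2: "roman_domination_number V (E - ?B2) \<le> roman_domination_number V E"
    using \<open>F \<subseteq> E\<close> x_count y_count by (intro stable) auto
  obtain g0 where g0: "roman_dominating V (E - ?B2) g0"
      "sum g0 V = roman_domination_number V (E - ?B2)"
    by (rule roman_domination_number_attained)
  have "\<exists>g. roman_dominating V (E - ?B2) g \<and> g y = 1 \<and> sum g V \<le> sum g0 V"
  proof (rule roman_dominating_isolated_vertex)
    show "\<not> adjacent (E - ?B2) y v" for v
      using xy by (auto simp: adjacent_def)
  qed (use ends g0 finite_verts in auto)
  then obtain g where g: "roman_dominating V (E - ?B2) g" "g y = 1" "sum g V \<le> sum g0 V"
    by blast
  have g': "roman_dominating V (E - F) g"
    by (rule roman_dominating_mono[OF g(1)]) auto

  have "2 * roman_domination_number V E < sum f V + sum g V"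
    using xy \<open>F \<subseteq> E\<close>
    by (intro roman_dominating_cut_edge_weight[OF finite_verts, of "E - F" E x A y f g])
      (use ends assms(4,5) cut f' f(2) g' g(2) in auto)
  then show False
    using f(3) f0(2) B1 g(3) g0(2) B2 by linarith
qed

section \<open>Minimum edge cuts\<close>

lemma edge_connectivity_attained:
  assumes "simple_graph V E" "card V \<ge> 2"
  obtains F where "F \<subseteq> E" "\<not> connected_graph V (E - F)" "card F = edge_connectivity V E"
proof -
  let ?S = "{card F | F. F \<subseteq> E \<and> \<not> connected_graph V (E - F)}"
  obtain u v where "u \<in> V" "v \<in> V" "u \<noteq> v"
    using assms(2) by (metis card_2_iff' obtain_subset_with_card_n subset_iff)
  moreover have "(adjacent {})\<^sup>*\<^sup>* u v \<Longrightarrow> u = v"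
    by (erule rtranclp.cases) (auto simp: adjacent_def)
  ultimately have "\<not> connected_graph V (E - E)"
    unfolding connected_graph_def by auto
  then have "?S \<noteq> {}" by blast
  then have "Inf ?S \<in> ?S" by (rule Inf_nat_def1)
  then show thesis
    using that unfolding edge_connectivity_def by auto
qed

lemma edge_connectivity_le:
  assumes "F \<subseteq> E" "\<not> connected_graph V (E - F)"
  shows "edge_connectivity V E \<le> card F"
proof -
  have "card F \<in> {card F | F. F \<subseteq> E \<and> \<not> connected_graph V (E - F)}"
    using assms by (intro CollectI exI[of _ F]) simp
  then show ?thesis
    unfolding edge_connectivity_def by (rule wellorder_Inf_le1)
qed

lemma rtranclp_adjacent_sym: "(adjacent E)\<^sup>*\<^sup>* u v \<Longrightarrow> (adjacent E)\<^sup>*\<^sup>* v u"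
proof -
  have "symp (adjacent E)" by (rule sympI) (simp add: adjacent_sym)
  then show "(adjacent E)\<^sup>*\<^sup>* u v \<Longrightarrow> (adjacent E)\<^sup>*\<^sup>* v u"
    by (meson symp_rtranclp sympD)
qed

text \<open>
  By minimality, putting one edge \<open>{x, y}\<close> of the cut back reconnects the graph. Hence that edge
  joins different components of \<open>G - F\<close>, and these are not both single vertices when there are at
  least three vertices.
\<close>

lemma minimum_edge_cut_properties:
  assumes "simple_graph V E" "card V \<ge> 3" "F \<subseteq> E" "\<not> connected_graph V (E - F)"
    and min: "card F = edge_connectivity V E" and xy: "{x, y} \<in> F"
  shows "\<not> (adjacent (E - F))\<^sup>*\<^sup>* x y"
    and "(\<exists>w. {x, w} \<in> E - F) \<or> (\<exists>w. {y, w} \<in> E - F)"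
proof -
  interpret simple_graph V E by fact
  let ?F' = "F - {{x, y}}"
  have "finite F" using finite_subset[OF \<open>F \<subseteq> E\<close> finite_edges] .
  then have "card ?F' < edge_connectivity V E"
    using xy min by (metis card_Diff1_less)
  then have conn: "connected_graph V (E - ?F')"
    using edge_connectivity_le[of ?F' E V] \<open>F \<subseteq> E\<close> by fastforce
  have step: "adjacent (E - F) u v \<or> {u, v} = {x, y}" if "adjacent (E - ?F') u v" for u v
    using that by (auto simp: adjacent_def)
  show "\<not> (adjacent (E - F))\<^sup>*\<^sup>* x y"
  proof
    assume reach: "(adjacent (E - F))\<^sup>*\<^sup>* x y"
    have step': "(adjacent (E - F))\<^sup>*\<^sup>* u v" if "adjacent (E - ?F') u v" for u v
      using step[OF that] reach rtranclp_adjacent_sym[OF reach]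
      by (auto simp: doubleton_eq_iff)
    have "(adjacent (E - F))\<^sup>*\<^sup>* u v" if "(adjacent (E - ?F'))\<^sup>*\<^sup>* u v" for u v
      using that by (induction rule: rtranclp_induct) (auto intro: rtranclp_trans step')
    then have "connected_graph V (E - F)"
      using conn unfolding connected_graph_def by blast
    with assms(4) show False ..
  qed
  show "(\<exists>w. {x, w} \<in> E - F) \<or> (\<exists>w. {y, w} \<in> E - F)"
  proof (rule ccontr)
    assume none: "\<not> ?thesis"
    have stay: "v \<in> {x, y}" if "(adjacent (E - ?F'))\<^sup>*\<^sup>* x v" for v
      using that
    proof (induction rule: rtranclp_induct)
      case (step u v)
      then show ?case
        using \<open>adjacent (E - ?F') u v \<Longrightarrow> adjacent (E - F) u v \<or> {u, v} = {x, y}\<close> none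
        by (auto simp: adjacent_def doubleton_eq_iff)
    qed simp
    have "x \<in> V" using edge_ends xy \<open>F \<subseteq> E\<close> by blast
    then have "V \<subseteq> {x, y}" using stay conn unfolding connected_graph_def by blast
    then have "card V \<le> card {x, y}" by (intro card_mono) auto
    also have "\<dots> \<le> 2" by (simp add: card_insert_if)
    finally show False using \<open>card V \<ge> 3\<close> by simp
  qed
qed

theorem theorem5p6:
  fixes V :: "'a set" and E :: "'a set set"
  assumes "simple_graph V E"
    and "connected_graph V E"
    and "card V \<ge> 3"
  shows "roman_bondage_number V E + 3 \<le> enat (2 * max_degree V E + edge_connectivity V E)"
proof -
  interpret simple_graph V E by fact
  obtain F where F: "F \<subseteq> E" "\<not> connected_graph V (E - F)" "card F = edge_connectivity V E"
    by (rule edge_connectivity_attained[OF assms(1)]) (use assms(3) in auto)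
  have "F \<noteq> {}" using F(2) assms(2) by auto
  then obtain x y where xy: "{x, y} \<in> F"
    using F(1) edges by (auto simp: card_2_iff) blast
  have ends: "x \<in> V" "y \<in> V" using edge_ends xy F(1) by blast+
  note cut = minimum_edge_cut_properties[OF assms(1,3) F xy]
  let ?A = "{v \<in> V. (adjacent (E - F))\<^sup>*\<^sup>* x v}"
  have closed: "\<not> adjacent (E - F) u v" if "u \<in> ?A" "v \<in> V - ?A" for u v
    using that by (auto intro: rtranclp.rtrancl_into_rtrancl)
  have sides: "x \<in> ?A" "y \<in> V - ?A" using ends cut(1) by auto
  have "\<exists>B\<subseteq>E. roman_domination_number V E < roman_domination_number V (E - B)
    \<and> card B + 3 \<le> 2 * max_degree V E + card F"
    using cut(2)
  proof (elim disjE exE)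
    fix w assume "{x, w} \<in> E - F"
    then show ?thesis
      using roman_bondage_at_cut_edge[OF F(1) xy _ sides closed] by blast
  next
    fix w assume yw: "{y, w} \<in> E - F"
    show ?thesis
    proof (rule roman_bondage_at_cut_edge[OF F(1) _ yw])
      show "{y, x} \<in> F" using xy by (simp add: insert_commute)
      show "y \<in> V - ?A" "x \<in> V - (V - ?A)" using sides ends by auto
      show "\<not> adjacent (E - F) u v" if "u \<in> V - ?A" "v \<in> V - (V - ?A)" for u v
        using that closed[of v u] adjacent_sym[of "E - F" u v] by auto
    qed
  qed
  then obtain B where B: "B \<subseteq> E" "roman_domination_number V E < roman_domination_number V (E - B)"
      "card B + 3 \<le> 2 * max_degree V E + card F"
    by blast
  have "roman_bondage_number V E \<le> enat (card B)"
    unfolding roman_bondage_number_def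
    using B by (intro Inf_lower CollectI exI[of _ B]) simp
  then have "roman_bondage_number V E + 3 \<le> enat (card B) + 3"
    by (rule add_right_mono)
  also have "\<dots> = enat (card B + 3)"
    by (simp add: numeral_eq_enat)
  also have "\<dots> \<le> enat (2 * max_degree V E + edge_connectivity V E)"
    using B(3) F(3) by simp
  finally show ?thesis .
qed

end
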